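(* Let $m\ge 1$, let $1<p_1,\dots,p_m<\infty$ and $p\in(1,\infty)$ satisfy $\frac1p=\frac1{p_1}+\dots+\frac1{p_m}$, let $\mathscr{D}$ be a dyadic grid in $\mathbb{R}^n$, and let $\sigma_1,\dots,\sigma_m$ be weights on $\mathbb{R}^n$. Suppose that the nonnegative numbers $\{a_Q\}_{Q\in\mathscr{D}}$ and the constant $A\geq 0$ satisfy $$\sum_{Q\in\mathscr{D},\,Q\subset R} a_Q\le A\int_R\prod_{i=1}^m\sigma_i^{\frac{p}{p_i}}\,dx\qquad\text{for all } R\in\mathscr{D}.$$ Then for all $f_i\in L^{p_i}(\sigma_i)$, $i=1,\dots,m$, $$\left(\sum_{Q\in\mathscr{D}}a_Q\Big(\prod_{i=1}^m\frac{1}{\sigma_i(Q)}\int_Q|f_i(y_i)|\,\sigma_i(y_i)\,dy_i\Big)^p\right)^{1/p}\le A^{1/p}\,\|\mathcal{M}^d_{\overrightarrow{\sigma}}(\overrightarrow f)\|_{L^p(\nu_{\overrightarrow\sigma})}\le A^{1/p}\prod_{i=1}^m p_i'\,\|f_i\|_{L^{p_i}(\sigma_i)}.$$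
   Context: A weight is a locally integrable function on $\mathbb{R}^n$ that is positive almost everywhere; for a weight $\sigma$ and a measurable set $E$, $\sigma(E)=\int_E\sigma\,dx$, and $\|f\|_{L^q(\sigma)}=\big(\int_{\mathbb{R}^n}|f|^q\sigma\,dx\big)^{1/q}$. For $1<q<\infty$, $q'=q/(q-1)$. A (general) dyadic grid $\mathscr{D}$ is a collection of cubes in $\mathbb{R}^n$ such that: (1) every $Q\in\mathscr{D}$ has sidelength $2^k$ for some $k\in\mathbb{Z}$; (2) $Q\cap R\in\{Q,R,\emptyset\}$ for any $Q,R\in\mathscr{D}$; (3) for each $k\in\mathbb{Z}$ the cubes in $\mathscr{D}$ of sidelength $2^k$ form a partition of $\mathbb{R}^n$. For $\overrightarrow\sigma=(\sigma_1,\dots,\sigma_m)$ put $\nu_{\overrightarrow\sigma}=\prod_{i=1}^m\sigma_i^{p/p_i}$, and for $\overrightarrow f=(f_1,\dots,f_m)$ define $$\mathcal{M}^d_{\overrightarrow\sigma}(\overrightarrow f)(x)=\sup_{Q\ni x,\ Q\in\mathscr{D}}\ \prod_{i=1}^m\frac{1}{\sigma_i(Q)}\int_Q|f_i(y_i)|\,\sigma_i(y_i)\,dy_i .$$ *)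

theory Defs
  imports "HOL-Analysis.Analysis"
begin

(* Axis-parallel cube with side length l.  Each face may or may not belong to the cube,
   so half-open, open and closed cubes are all covered. *)
definition cube_of_side :: "real \<Rightarrow> (real ^ 'n) set \<Rightarrow> bool" where
  "cube_of_side l Q \<longleftrightarrow> l > 0 \<and>
     (\<exists>c I. (\<forall>i. {c $ i <..< c $ i + l} \<subseteq> I i \<and> I i \<subseteq> {c $ i .. c $ i + l}) \<and>
            Q = {x. \<forall>i. x $ i \<in> I i})"

definition dyadic_grid :: "(real ^ 'n) set set \<Rightarrow> bool" where
  "dyadic_grid D \<longleftrightarrow>
     (\<forall>Q\<in>D. \<exists>k::int. cube_of_side (2 powi k) Q) \<and>
     (\<forall>Q\<in>D. \<forall>R\<in>D. Q \<inter> R \<in> {Q, R, {}}) \<and>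
     (\<forall>k::int. partition_on UNIV {Q\<in>D. cube_of_side (2 powi k) Q})"

definition weight :: "(real ^ 'n \<Rightarrow> real) \<Rightarrow> bool" where
  "weight w \<longleftrightarrow>
     (\<forall>K. compact K \<longrightarrow> set_integrable lebesgue K w) \<and> (AE x in lebesgue. w x > 0)"

(* Power of an extended nonnegative number, meant for exponents a > 0 only. *)
definition enn_powr :: "ennreal \<Rightarrow> real \<Rightarrow> ennreal" where
  "enn_powr x a = (if x = \<infinity> then \<infinity> else ennreal (enn2real x powr a))"

(* The norm of L^q(w), with value \<infinity> allowed, for a function g with values in [0, \<infinity>];
   g is extended-valued because a maximal function may be infinite at some points. *)
definition weighted_norm :: "real \<Rightarrow> (real ^ 'n \<Rightarrow> real) \<Rightarrow> (real ^ 'n \<Rightarrow> ennreal) \<Rightarrow> ennreal" where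
  "weighted_norm q w g = enn_powr (\<integral>\<^sup>+ x. enn_powr (g x) q * ennreal (w x) \<partial>lebesgue) (1 / q)"

definition in_weighted_Lp :: "real \<Rightarrow> (real ^ 'n \<Rightarrow> real) \<Rightarrow> (real ^ 'n \<Rightarrow> complex) \<Rightarrow> bool" where
  "in_weighted_Lp q w f \<longleftrightarrow>
     f \<in> borel_measurable lebesgue \<and> weighted_norm q w (\<lambda>x. ennreal (cmod (f x))) < \<infinity>"

definition conj_exponent :: "real \<Rightarrow> real" where
  "conj_exponent q = q / (q - 1)"

definition weighted_avg ::
  "(real ^ 'n \<Rightarrow> real) \<Rightarrow> (real ^ 'n \<Rightarrow> complex) \<Rightarrow> (real ^ 'n) set \<Rightarrow> ennreal" where
  "weighted_avg w f Q =
     (\<integral>\<^sup>+ y\<in>Q. ennreal (cmod (f y) * w y) \<partial>lebesgue) / (\<integral>\<^sup>+ y\<in>Q. ennreal (w y) \<partial>lebesgue)"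

(* m-tuples are indexed by 1, ..., m; values at other indices are irrelevant. *)
definition nu_weight ::
  "nat \<Rightarrow> real \<Rightarrow> (nat \<Rightarrow> real) \<Rightarrow> (nat \<Rightarrow> real ^ 'n \<Rightarrow> real) \<Rightarrow> real ^ 'n \<Rightarrow> real" where
  "nu_weight m p ps \<sigma> x = (\<Prod>i=1..m. \<sigma> i x powr (p / ps i))"

definition dyadic_maximal ::
  "(real ^ 'n) set set \<Rightarrow> nat \<Rightarrow> (nat \<Rightarrow> real ^ 'n \<Rightarrow> real) \<Rightarrow> (nat \<Rightarrow> real ^ 'n \<Rightarrow> complex)
     \<Rightarrow> real ^ 'n \<Rightarrow> ennreal" where
  "dyadic_maximal D m \<sigma> f x = (SUP Q\<in>{Q\<in>D. x \<in> Q}. \<Prod>i=1..m. weighted_avg (\<sigma> i) (f i) Q)"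

end

theory Submission
  imports Defs
begin

text \<open>
  Both inequalities rest on the tree structure of dyadic cubes: among finitely many of them, the
  maximal ones are pairwise disjoint and cover the same set. An estimate that is known on single
  cubes therefore extends to every finite union of cubes, in particular to the level sets of a
  maximal function taken over finitely many cubes.

  Let \<open>\<nu>\<close> be the measure with density \<open>nu_weight\<close>. For the first inequality write \<open>c Q\<close> for the
  \<open>p\<close>-th power of the product of averages over \<open>Q\<close>. The cubes with \<open>c Q \<ge> t\<close> have as union the level
  set \<open>{M c \<ge> t}\<close> of the maximal function \<open>M c x = sup {c Q | x \<in> Q}\<close>, so the Carleson condition
  bounds the sum of their coefficients by \<open>A\<close> times the \<open>\<nu>\<close>-measure of that level set. Summation
  over the levels (the layer-cake formula) gives \<open>\<Sum> a Q * c Q \<le> A * \<integral> M c d\<nu>\<close>, and \<open>M c\<close> is the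
  \<open>p\<close>-th power of the multilinear maximal function because powers commute with suprema.

  For the second inequality, the multilinear maximal function is at most the product of the
  one-weight maximal functions of the \<open>f i\<close>. Since the exponents \<open>p / ps i\<close> add up to 1, Hoelder's
  inequality turns the norm of this product into the product of the norms in \<open>L^(ps i)(\<sigma> i)\<close>, and
  each factor is controlled by Doob's maximal inequality with constant \<open>ps i / (ps i - 1)\<close>. Doob's
  inequality follows from the weak-type bound on level sets by the same layer-cake argument,
  together with Young's inequality.

  An infinite grid need not have maximal cubes above a given level. Both arguments are therefore run
  on finite families of cubes, where the maximal functions take finitely many values and the
  layer-cake integral is a finite sum, and the general case follows by taking suprema: a sum of
  nonnegative terms is the supremum of its finite partial sums, and a countable grid is exhausted by
  finite families. The main steps are \<open>carleson_embedding_finite\<close>, \<open>doob_finite\<close>,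
  \<open>weighted_dyadic_maximal_bound\<close>, \<open>dyadic_carleson_embedding\<close> and \<open>weighted_norm_prod_le\<close>.
\<close>

section \<open>Powers of extended nonnegative numbers\<close>

lemma enn_powr_ennreal: "0 \<le> x \<Longrightarrow> enn_powr (ennreal x) a = ennreal (x powr a)"
  by (simp add: enn_powr_def)

lemma enn_powr_top: "enn_powr top a = top"
  by (simp add: enn_powr_def)

lemma enn_powr_zero: "enn_powr 0 a = 0"
  by (simp add: enn_powr_def)

lemma enn_powr_eq_0_iff: "enn_powr x a = 0 \<longleftrightarrow> x = 0"
  by (cases x) (auto simp: enn_powr_ennreal enn_powr_top)

lemma enn_powr_eq_top_iff: "enn_powr x a = top \<longleftrightarrow> x = top"
  by (cases x) (auto simp: enn_powr_ennreal enn_powr_top)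

lemma enn_powr_mono:
  assumes "0 < a" "x \<le> y"
  shows "enn_powr x a \<le> enn_powr y a"
proof (cases y)
  case (real r)
  with assms show ?thesis
    by (cases x) (auto simp: enn_powr_ennreal top_unique intro!: ennreal_leI powr_mono2)
qed (simp add: enn_powr_top)

text \<open>
  Multiplicativity survives the values \<open>0\<close> and \<open>\<infinity>\<close>: the product \<open>0 * \<infinity>\<close> is 0 on both sides, and a
  power is 0 or \<open>\<infinity>\<close> exactly when its base is.
\<close>

lemma enn_powr_mult:
  "enn_powr (x * y) a = enn_powr x a * enn_powr y a"
proof (cases "x = top \<or> y = top")
  case True
  then show ?thesis
    by (auto simp: enn_powr_top ennreal_mult_top ennreal_top_mult enn_powr_zero enn_powr_eq_0_iff)
next
  case False
  then obtain r s where "x = ennreal r" "y = ennreal s" "0 \<le> r" "0 \<le> s"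
    by (metis ennreal_cases)
  then show ?thesis
    by (simp add: enn_powr_ennreal powr_mult flip: ennreal_mult)
qed

lemma enn_powr_one_base: "enn_powr 1 a = 1"
  using enn_powr_ennreal[of 1 a] by simp

lemma enn_powr_one: "enn_powr x 1 = x"
  by (cases x) (auto simp: enn_powr_ennreal enn_powr_top)

lemma enn_powr_prod: "enn_powr (\<Prod>i\<in>I. x i) a = (\<Prod>i\<in>I. enn_powr (x i) a)"
  by (induction I rule: infinite_finite_induct) (auto simp: enn_powr_mult enn_powr_one_base)

lemma enn_powr_powr: "enn_powr (enn_powr x a) b = enn_powr x (a * b)"
  by (cases x) (auto simp: enn_powr_ennreal enn_powr_top powr_powr)

text \<open>
  This Galois connection is what makes powers commute with arbitrary suprema.
\<close>

lemma enn_powr_le_iff: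
  assumes "0 < a"
  shows "enn_powr x a \<le> y \<longleftrightarrow> x \<le> enn_powr y (1 / a)"
  using enn_powr_mono[of "1 / a" "enn_powr x a" y] enn_powr_mono[of a x "enn_powr y (1 / a)"] assms
  by (auto simp: enn_powr_powr enn_powr_one)

lemma enn_powr_SUP:
  assumes "0 < a"
  shows "enn_powr (SUP i\<in>I. x i) a = (SUP i\<in>I. enn_powr (x i) a)"
proof (rule antisym)
  show "enn_powr (SUP i\<in>I. x i) a \<le> (SUP i\<in>I. enn_powr (x i) a)"
    unfolding enn_powr_le_iff[OF assms]
    by (rule SUP_least, unfold enn_powr_le_iff[OF assms, symmetric]) (rule SUP_upper)
  show "(SUP i\<in>I. enn_powr (x i) a) \<le> enn_powr (SUP i\<in>I. x i) a"
    by (intro SUP_least enn_powr_mono assms SUP_upper)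
qed

lemma borel_measurable_enn_powr [measurable (raw)]:
  assumes [measurable]: "g \<in> borel_measurable M"
  shows "(\<lambda>x. enn_powr (g x) a) \<in> borel_measurable M"
  unfolding enn_powr_def by measurable

section \<open>Hoelder's inequality for several functions\<close>

text \<open>
  Convexity of the exponential, applied to the logarithms. Indices with \<open>x i = 0\<close> have no logarithm
  but make the left-hand side vanish.
\<close>

lemma weighted_am_gm:
  fixes x \<theta> :: "'i \<Rightarrow> real"
  assumes I: "finite I" "I \<noteq> {}" and \<theta>: "\<And>i. i \<in> I \<Longrightarrow> 0 < \<theta> i" "(\<Sum>i\<in>I. \<theta> i) = 1"
    and x: "\<And>i. i \<in> I \<Longrightarrow> 0 \<le> x i"
  shows "(\<Prod>i\<in>I. x i powr \<theta> i) \<le> (\<Sum>i\<in>I. \<theta> i * x i)"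
proof (cases "\<exists>i\<in>I. x i = 0")
  case True
  then have "(\<Prod>i\<in>I. x i powr \<theta> i) = 0"
    using I by auto
  then show ?thesis
    using \<theta>(1) x by (simp add: sum_nonneg less_imp_le)
next
  case False
  then have pos: "x i > 0" if "i \<in> I" for i
    using x[OF that] that by force
  have "(\<Prod>i\<in>I. x i powr \<theta> i) = (\<Prod>i\<in>I. exp (\<theta> i * ln (x i)))"
    using pos by (intro prod.cong refl) (force simp: powr_def)
  also have "\<dots> = exp (\<Sum>i\<in>I. \<theta> i *\<^sub>R ln (x i))"
    using I by (simp add: exp_sum)
  also have "\<dots> \<le> (\<Sum>i\<in>I. \<theta> i * exp (ln (x i)))"
    using I \<theta> by (intro convex_on_sum[OF _ _ exp_convex]) (auto simp: less_imp_le)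
  also have "\<dots> = (\<Sum>i\<in>I. \<theta> i * x i)"
    using pos by (intro sum.cong) auto
  finally show ?thesis .
qed

lemma enn_weighted_am_gm:
  fixes x :: "'i \<Rightarrow> ennreal" and \<theta> :: "'i \<Rightarrow> real"
  assumes I: "finite I" "I \<noteq> {}" and \<theta>: "\<And>i. i \<in> I \<Longrightarrow> 0 < \<theta> i" "(\<Sum>i\<in>I. \<theta> i) = 1"
  shows "(\<Prod>i\<in>I. enn_powr (x i) (\<theta> i)) \<le> (\<Sum>i\<in>I. ennreal (\<theta> i) * x i)"
proof (cases "\<exists>i\<in>I. x i = top")
  case True
  then obtain j where "j \<in> I" "x j = top" by blast
  then have "(\<Sum>i\<in>I. ennreal (\<theta> i) * x i) = top"
    using I \<theta>(1)[of j] member_le_sum[of j I "\<lambda>i. ennreal (\<theta> i) * x i"]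
    by (simp add: ennreal_mult_top top_unique)
  then show ?thesis by simp
next
  case False
  have *: "(\<Prod>i\<in>I. enn2real (x i) powr \<theta> i) \<le> (\<Sum>i\<in>I. \<theta> i * enn2real (x i))"
    by (rule weighted_am_gm[OF I \<theta>]) auto
  have "(\<Prod>i\<in>I. enn_powr (x i) (\<theta> i)) = (\<Prod>i\<in>I. ennreal (enn2real (x i) powr \<theta> i))"
    using False by (intro prod.cong) (auto simp: enn_powr_def)
  also have "\<dots> = ennreal (\<Prod>i\<in>I. enn2real (x i) powr \<theta> i)"
    by (simp add: prod_ennreal)
  also have "\<dots> \<le> ennreal (\<Sum>i\<in>I. \<theta> i * enn2real (x i))"
    using * by (rule ennreal_leI)
  also have "\<dots> = (\<Sum>i\<in>I. ennreal (\<theta> i * enn2real (x i)))"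
    using \<theta>(1) by (subst sum_ennreal) (auto simp: less_imp_le)
  also have "\<dots> = (\<Sum>i\<in>I. ennreal (\<theta> i) * x i)"
    using False \<theta>(1) by (intro sum.cong) (auto simp: ennreal_mult less_imp_le less_top)
  finally show ?thesis .
qed

text \<open>
  Once every \<open>g i\<close> is divided by its integral, the inequality between arithmetic and geometric means
  can be integrated term by term. Integrals equal to \<open>0\<close> or \<open>\<infinity>\<close> cannot be normalised; in these cases
  the left-hand side vanishes or the right-hand side is infinite.
\<close>

lemma nn_integral_Hoelder:
  fixes g :: "'i \<Rightarrow> 'a \<Rightarrow> ennreal" and \<theta> :: "'i \<Rightarrow> real"
  assumes I: "finite I" "I \<noteq> {}" and \<theta>: "\<And>i. i \<in> I \<Longrightarrow> 0 < \<theta> i" "(\<Sum>i\<in>I. \<theta> i) = 1"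
    and g [measurable]: "\<And>i. i \<in> I \<Longrightarrow> g i \<in> borel_measurable M"
  shows "(\<integral>\<^sup>+ x. (\<Prod>i\<in>I. enn_powr (g i x) (\<theta> i)) \<partial>M)
           \<le> (\<Prod>i\<in>I. enn_powr (\<integral>\<^sup>+ x. g i x \<partial>M) (\<theta> i))"
proof -
  define J where "J i = (\<integral>\<^sup>+ x. g i x \<partial>M)" for i
  consider (zero) "\<exists>i\<in>I. J i = 0" | (top) "\<forall>i\<in>I. J i \<noteq> 0" "\<exists>i\<in>I. J i = top"
    | (fin) "\<forall>i\<in>I. J i \<noteq> 0 \<and> J i \<noteq> top"
    by blast
  then show ?thesis
  proof cases
    case zero
    then obtain j where j: "j \<in> I" "J j = 0" by blast
    then have "AE x in M. g j x = 0"
      unfolding J_def by (subst (asm) nn_integral_0_iff_AE) auto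
    then have "AE x in M. (\<Prod>i\<in>I. enn_powr (g i x) (\<theta> i)) = 0"
      by eventually_elim (use j I in \<open>auto simp: enn_powr_eq_0_iff\<close>)
    then have "(\<integral>\<^sup>+ x. (\<Prod>i\<in>I. enn_powr (g i x) (\<theta> i)) \<partial>M) = (\<integral>\<^sup>+ x. 0 \<partial>M)"
      by (rule nn_integral_cong_AE)
    then show ?thesis by simp
  next
    case top
    then have "(\<Prod>i\<in>I. enn_powr (J i) (\<theta> i)) = top"
      using I by (subst ennreal_prod_eq_top) (auto simp: enn_powr_eq_0_iff enn_powr_eq_top_iff)
    then show ?thesis by (simp add: J_def)
  next
    case fin
    \<comment> \<open>Normalised functions \<open>g i / J i\<close> have integral 1.\<close>
    have norm: "g i x = J i * (g i x / J i)" if "i \<in> I" for i x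
      using fin that mult_divide_eq_ennreal[of "J i" "g i x"] by (simp add: ennreal_times_divide mult.commute)
    have "(\<integral>\<^sup>+ x. (\<Prod>i\<in>I. enn_powr (g i x) (\<theta> i)) \<partial>M)
        = (\<integral>\<^sup>+ x. (\<Prod>i\<in>I. enn_powr (J i) (\<theta> i)) * (\<Prod>i\<in>I. enn_powr (g i x / J i) (\<theta> i)) \<partial>M)"
      by (intro nn_integral_cong)
        (auto simp flip: prod.distrib enn_powr_mult norm intro!: prod.cong)
    also have "\<dots> = (\<Prod>i\<in>I. enn_powr (J i) (\<theta> i)) * (\<integral>\<^sup>+ x. (\<Prod>i\<in>I. enn_powr (g i x / J i) (\<theta> i)) \<partial>M)"
      by (rule nn_integral_cmult) measurable
    also have "(\<integral>\<^sup>+ x. (\<Prod>i\<in>I. enn_powr (g i x / J i) (\<theta> i)) \<partial>M)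
        \<le> (\<integral>\<^sup>+ x. (\<Sum>i\<in>I. ennreal (\<theta> i) * (g i x / J i)) \<partial>M)"
      by (intro nn_integral_mono enn_weighted_am_gm I \<theta>)
    also have "\<dots> = (\<Sum>i\<in>I. ennreal (\<theta> i) * (J i / J i))"
      unfolding J_def by (subst nn_integral_sum) (auto simp: nn_integral_cmult nn_integral_divide)
    also have "\<dots> = (\<Sum>i\<in>I. ennreal (\<theta> i))"
      using fin by (intro sum.cong) (auto simp: ennreal_divide_self less_top)
    also have "\<dots> = 1"
      using \<theta> by (subst sum_ennreal) (auto simp: less_imp_le)
    finally show ?thesis by (simp add: J_def mult_left_mono)
  qed
qed

section \<open>Finite nested families of sets\<close>

text \<open>
  Any two members are comparable or disjoint: the tree structure of a dyadic grid, detached from the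
  geometry of cubes.
\<close>

definition nested :: "'a set set \<Rightarrow> bool" where
  "nested F \<longleftrightarrow> (\<forall>Q\<in>F. \<forall>R\<in>F. Q \<inter> R \<in> {Q, R, {}})"

definition maximal_sets :: "'a set set \<Rightarrow> 'a set set" where
  "maximal_sets F = {Q\<in>F. \<forall>R\<in>F. Q \<subseteq> R \<longrightarrow> Q = R}"

lemma nested_subset: "nested F \<Longrightarrow> G \<subseteq> F \<Longrightarrow> nested G"
  by (auto simp: nested_def subset_iff)

lemma maximal_sets_subset: "maximal_sets F \<subseteq> F"
  by (auto simp: maximal_sets_def)

lemma disjoint_maximal_sets: "nested F \<Longrightarrow> disjoint (maximal_sets F)"
  unfolding nested_def maximal_sets_def disjoint_def
  by (smt (verit) Int_lower1 Int_lower2 insertE mem_Collect_eq singletonD)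

lemma maximal_set_above:
  assumes "finite F" "Q \<in> F"
  obtains R where "R \<in> maximal_sets F" "Q \<subseteq> R"
  using finite_has_maximal2[OF assms] unfolding maximal_sets_def by auto

lemma Union_maximal_sets: "finite F \<Longrightarrow> \<Union>(maximal_sets F) = \<Union>F"
  using maximal_sets_subset[of F] by (blast elim: maximal_set_above)

text \<open>
  The form in which disjointness of the maximal members enters: integrals over the union split into
  integrals over the maximal members.
\<close>

lemma sum_indicator_maximal_sets:
  assumes "finite F" "nested F"
  shows "(\<Sum>R\<in>maximal_sets F. indicator R x) = (indicator (\<Union>F) x :: ennreal)"
proof -
  have "finite (maximal_sets F)"
    using assms(1) maximal_sets_subset finite_subset by blast
  moreover have "disjoint_family_on (\<lambda>R. R) (maximal_sets F)"
    using disjoint_maximal_sets[OF assms(2)] by (auto simp: disjoint_family_on_def disjoint_def)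
  ultimately have "(indicator (\<Union>R\<in>maximal_sets F. R) x :: ennreal) = (\<Sum>R\<in>maximal_sets F. indicator R x)"
    by (rule indicator_UN_disjoint)
  then show ?thesis
    by (simp add: Union_maximal_sets[OF assms(1)])
qed

lemma nn_integral_Union_nested:
  assumes "finite F" "nested F" and [measurable]: "\<And>Q. Q \<in> F \<Longrightarrow> Q \<in> sets M" "g \<in> borel_measurable M"
  shows "(\<integral>\<^sup>+ x\<in>\<Union>F. g x \<partial>M) = (\<Sum>R\<in>maximal_sets F. \<integral>\<^sup>+ x\<in>R. g x \<partial>M)"
proof -
  have [measurable]: "R \<in> sets M" if "R \<in> maximal_sets F" for R
    using that maximal_sets_subset assms(3) by blast
  show ?thesis
    by (simp add: nn_integral_sum sum_distrib_left flip: sum_indicator_maximal_sets[OF assms(1,2)])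
qed

lemma emeasure_Union_nested:
  assumes "finite F" "nested F" and [measurable]: "\<And>Q. Q \<in> F \<Longrightarrow> Q \<in> sets M"
  shows "emeasure M (\<Union>F) = (\<Sum>R\<in>maximal_sets F. emeasure M R)"
proof -
  have "\<Union>F \<in> sets M" and "\<And>R. R \<in> maximal_sets F \<Longrightarrow> R \<in> sets M"
    using maximal_sets_subset assms by blast+
  then show ?thesis
    using nn_integral_Union_nested[OF assms, where g = "\<lambda>_. 1"] by simp
qed

section \<open>Layer-cake formula for finite maximal functions\<close>

text \<open>
  The maximal function of a finite family. The inserted \<open>0\<close> is the value outside the union of the
  family.
\<close>

definition finmax :: "'a set set \<Rightarrow> ('a set \<Rightarrow> real) \<Rightarrow> 'a \<Rightarrow> real" where
  "finmax F \<phi> x = Max (insert 0 (\<phi> ` {Q\<in>F. x \<in> Q}))"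

text \<open>
  The level sets of a maximal function are unions of members of the family. At the level \<open>t = 0\<close>
  this breaks down, because \<open>0 \<le> finmax F \<phi> x\<close> also holds outside the union of the family.
\<close>

lemma finmax_ge_iff:
  assumes "finite F" "0 < t"
  shows "t \<le> finmax F \<phi> x \<longleftrightarrow> x \<in> \<Union>{Q\<in>F. t \<le> \<phi> Q}"
  using assms unfolding finmax_def by (subst Max_ge_iff) auto

lemma finmax_in: "finite F \<Longrightarrow> finmax F \<phi> x \<in> insert 0 (\<phi> ` F)"
  using Max_in[of "insert 0 (\<phi> ` {Q\<in>F. x \<in> Q})"] unfolding finmax_def by auto

text \<open>
  The values in \<open>V\<close> together with the base value \<open>0\<close>, listed increasingly as \<open>0 = l 0 < \<dots> < l k\<close>.
\<close>

definition enumerates :: "nat \<Rightarrow> (nat \<Rightarrow> real) \<Rightarrow> real set \<Rightarrow> bool" where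
  "enumerates k l V \<longleftrightarrow> l 0 = 0 \<and> strict_mono_on {..k} l \<and> insert 0 V = l ` {..k}"

lemma ex_enumerates:
  fixes V :: "real set"
  assumes "finite V" "\<And>v. v \<in> V \<Longrightarrow> 0 \<le> v"
  shows "\<exists>k l. enumerates k l V"
proof -
  let ?W = "insert 0 V" and ?s = "sorted_list_of_set (insert 0 V)"
  have W: "finite ?W" using assms by simp
  have len: "length ?s = card ?W" "card ?W > 0"
    using W by (auto simp: card_gt_0_iff simp del: sorted_list_of_set_insert_remove)
  have sm: "strict_mono_on {..card ?W - 1} (\<lambda>i. ?s ! i)"
    using strict_sorted_list_of_set[of ?W] len
    by (auto simp: strict_mono_on_def sorted_wrt_iff_nth_less)
  have im: "?W = (\<lambda>i. ?s ! i) ` {..card ?W - 1}"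
  proof -
    have "?W = set ?s" using W by (rule set_sorted_list_of_set[symmetric])
    also have "\<dots> = (\<lambda>i. ?s ! i) ` {..<length ?s}"
      by (auto simp: set_conv_nth)
    also have "{..<length ?s} = {..card ?W - 1}"
      using len by auto
    finally show ?thesis .
  qed
  have "?s ! 0 = 0"
  proof -
    have "?s ! 0 = Min ?W" 
      using sorted_list_of_set_nonempty[OF W] by simp
    also have "\<dots> = 0" using assms by (intro Min_eqI) auto
    finally show ?thesis .
  qed
  then show ?thesis using sm im unfolding enumerates_def by blast
qed

lemma enumerates_incr:
  assumes "enumerates k l V" "1 \<le> j" "j \<le> k"
  shows "0 \<le> l (j - 1)" "l (j - 1) < l j"
proof -
  have l: "l 0 = 0" "strict_mono_on {..k} l"
    using assms(1) by (auto simp: enumerates_def)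
  show "0 \<le> l (j - 1)"
    using strict_mono_on_leD[OF l(2), of 0 "j - 1"] l(1) assms(3) by simp
  show "l (j - 1) < l j"
    using strict_mono_onD[OF l(2), of "j - 1" j] assms(2,3) by simp
qed

lemma telescope_values:
  fixes \<Phi> :: "real \<Rightarrow> real"
  assumes "enumerates k l V" "v \<in> insert 0 V" "\<Phi> 0 = 0"
  shows "\<Phi> v = (\<Sum>j=1..k. (\<Phi> (l j) - \<Phi> (l (j - 1))) * of_bool (l j \<le> v))"
proof -
  have l: "l 0 = 0" "strict_mono_on {..k} l" "insert 0 V = l ` {..k}"
    using assms(1) by (auto simp: enumerates_def)
  obtain n where n: "n \<le> k" "v = l n" using assms(2) l(3) by auto
  have le: "l j \<le> l n \<longleftrightarrow> j \<le> n" if "j \<le> k" for j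
    using strict_mono_on_less_eq[OF l(2), of j n] that n by simp
  have "(\<Sum>j=1..k. (\<Phi> (l j) - \<Phi> (l (j - 1))) * of_bool (l j \<le> v))
      = (\<Sum>j=1..n. \<Phi> (l j) - \<Phi> (l (j - 1)))"
    using n le by (intro sum.mono_neutral_cong_right) auto
  also have "\<dots> = (\<Sum>i<n. \<Phi> (l (Suc i)) - \<Phi> (l i))"
    by (rule sum.reindex_bij_witness[of _ Suc "\<lambda>j. j - 1"]) auto
  also have "\<dots> = \<Phi> v"
    using assms(3) l(1) n by (simp add: sum_lessThan_telescope[of "\<lambda>i. \<Phi> (l i)"])
  finally show ?thesis by simp
qed

definition level_union :: "'a set set \<Rightarrow> ('a set \<Rightarrow> real) \<Rightarrow> real \<Rightarrow> 'a set" where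
  "level_union F \<phi> t = \<Union>{Q\<in>F. t \<le> \<phi> Q}"

text \<open>
  A discrete form of \<open>\<Phi> v = \<integral> \<Phi>'(t) 1[t \<le> v] dt\<close>: the increments of \<open>\<Phi>\<close> between consecutive levels
  play the role of \<open>\<Phi>'(t) dt\<close>. The cases \<open>\<Phi> t = t\<close> and \<open>\<Phi> t = t powr r\<close> serve below.
\<close>

lemma layer_cake_value:
  fixes \<Phi> :: "real \<Rightarrow> real"
  assumes l: "enumerates k l V" and v: "v \<in> insert 0 V" and \<Phi>: "mono_on {0..} \<Phi>" "\<Phi> 0 = 0"
  shows "ennreal (\<Phi> v) = (\<Sum>j=1..k. ennreal (\<Phi> (l j) - \<Phi> (l (j - 1))) * of_bool (l j \<le> v))"
proof -
  have inc: "0 \<le> \<Phi> (l j) - \<Phi> (l (j - 1))" if "j \<in> {1..k}" for j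
    using mono_onD[OF \<Phi>(1), of "l (j - 1)" "l j"] enumerates_incr[OF l, of j] that by simp
  have "\<Phi> v = (\<Sum>j=1..k. (\<Phi> (l j) - \<Phi> (l (j - 1))) * of_bool (l j \<le> v))"
    by (rule telescope_values[where \<Phi> = \<Phi>, OF l v \<Phi>(2)])
  also have "ennreal \<dots> = (\<Sum>j=1..k. ennreal ((\<Phi> (l j) - \<Phi> (l (j - 1))) * of_bool (l j \<le> v)))"
    using inc by (intro sum_ennreal[symmetric]) simp
  also have "\<dots> = (\<Sum>j=1..k. ennreal (\<Phi> (l j) - \<Phi> (l (j - 1))) * of_bool (l j \<le> v))"
    by (intro sum.cong) auto
  finally show ?thesis .
qed

lemma layer_cake_finmax:
  fixes \<Phi> :: "real \<Rightarrow> real"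
  assumes F: "finite F" and l: "enumerates k l (\<phi> ` F)" and \<Phi>: "mono_on {0..} \<Phi>" "\<Phi> 0 = 0"
  shows "ennreal (\<Phi> (finmax F \<phi> x))
    = (\<Sum>j=1..k. ennreal (\<Phi> (l j) - \<Phi> (l (j - 1))) * indicator (level_union F \<phi> (l j)) x)"
  unfolding layer_cake_value[where \<Phi> = \<Phi>, OF l finmax_in[OF F] \<Phi>]
proof (intro sum.cong refl arg_cong2[where f = "(*)"])
  fix j assume "j \<in> {1..k}"
  then have "0 < l j" using enumerates_incr[OF l, of j] by auto
  then show "of_bool (l j \<le> finmax F \<phi> x) = (indicator (level_union F \<phi> (l j)) x :: ennreal)"
    by (auto simp: finmax_ge_iff[OF F] level_union_def indicator_def)
qed

lemma sets_level_union:
  "finite F \<Longrightarrow> (\<And>Q. Q \<in> F \<Longrightarrow> Q \<in> sets M) \<Longrightarrow> level_union F \<phi> t \<in> sets M"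
  unfolding level_union_def by (rule sets.finite_Union) auto

lemma layer_cake_integral:
  fixes \<Phi> :: "real \<Rightarrow> real"
  assumes F: "finite F" "\<And>Q. Q \<in> F \<Longrightarrow> Q \<in> sets M"
    and l: "enumerates k l (\<phi> ` F)" and \<Phi>: "mono_on {0..} \<Phi>" "\<Phi> 0 = 0"
  shows "(\<integral>\<^sup>+ x. ennreal (\<Phi> (finmax F \<phi> x)) \<partial>M)
    = (\<Sum>j=1..k. ennreal (\<Phi> (l j) - \<Phi> (l (j - 1))) * emeasure M (level_union F \<phi> (l j)))"
proof -
  have U [measurable]: "level_union F \<phi> t \<in> sets M" for t
    using F by (rule sets_level_union)
  show ?thesis
    unfolding layer_cake_finmax[where \<Phi> = \<Phi>, OF F(1) l \<Phi>]
    by (subst nn_integral_sum) (auto simp: nn_integral_cmult_indicator)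
qed

lemma finmax_nonneg: "finite F \<Longrightarrow> 0 \<le> finmax F \<phi> x"
  unfolding finmax_def by (rule Max_ge) auto

lemma borel_measurable_finmax:
  assumes F: "finite F" "\<And>Q. Q \<in> F \<Longrightarrow> Q \<in> sets M"
  shows "finmax F \<phi> \<in> borel_measurable M"
proof (rule borel_measurable_iff_ge[THEN iffD2], rule allI)
  fix t
  have "{x \<in> space M. t \<le> finmax F \<phi> x} = (if 0 < t then space M \<inter> level_union F \<phi> t else space M)"
    using finmax_ge_iff[OF F(1), of t \<phi>] finmax_nonneg[OF F(1), of \<phi>]
    by (auto simp: level_union_def not_less intro: order_trans[of _ 0])
  then show "{x \<in> space M. t \<le> finmax F \<phi> x} \<in> sets M"
    using sets_level_union[OF F, of \<phi> t] by auto
qed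

text \<open>
  The link from the real-valued finite maximal function to suprema in \<open>[0, \<infinity>]\<close>; the empty supremum
  there is 0 as well.
\<close>

lemma ennreal_finmax:
  assumes "finite F" "\<And>Q. Q \<in> F \<Longrightarrow> 0 \<le> \<phi> Q"
  shows "ennreal (finmax F \<phi> x) = (SUP Q\<in>{Q\<in>F. x \<in> Q}. ennreal (\<phi> Q))"
proof (rule antisym)
  have "finmax F \<phi> x \<in> insert 0 (\<phi> ` {Q\<in>F. x \<in> Q})"
    unfolding finmax_def by (rule Max_in) (use assms in auto)
  then consider "finmax F \<phi> x = 0" | Q where "Q \<in> {Q\<in>F. x \<in> Q}" "finmax F \<phi> x = \<phi> Q"
    by blast
  then show "ennreal (finmax F \<phi> x) \<le> (SUP Q\<in>{Q\<in>F. x \<in> Q}. ennreal (\<phi> Q))"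
  proof cases
    case 2
    then show ?thesis
      using SUP_upper[of Q "{Q\<in>F. x \<in> Q}" "\<lambda>Q. ennreal (\<phi> Q)"] by simp
  qed simp
  show "(SUP Q\<in>{Q\<in>F. x \<in> Q}. ennreal (\<phi> Q)) \<le> ennreal (finmax F \<phi> x)"
    unfolding finmax_def by (intro SUP_least ennreal_leI Max_ge) (use assms in auto)
qed

section \<open>Carleson embedding for finite nested families\<close>

text \<open>
  Every member of \<open>F\<close> lies below a maximal one, so the sum splits into groups that are controlled by
  the Carleson condition on the maximal members, whose measures add up to that of the union.
\<close>

lemma carleson_Union:
  fixes a :: "'a set \<Rightarrow> ennreal"
  assumes F: "finite F" "nested F" "\<And>Q. Q \<in> F \<Longrightarrow> Q \<in> sets M"
    and carleson: "\<And>R. R \<in> F \<Longrightarrow> (\<Sum>Q\<in>{Q\<in>F. Q \<subseteq> R}. a Q) \<le> C * emeasure M R"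
  shows "(\<Sum>Q\<in>F. a Q) \<le> C * emeasure M (\<Union>F)"
proof -
  have fin: "finite (maximal_sets F)"
    using F(1) maximal_sets_subset finite_subset by blast
  have "(\<Sum>Q\<in>F. a Q) \<le> (\<Sum>Q\<in>F. \<Sum>R\<in>maximal_sets F. a Q * of_bool (Q \<subseteq> R))"
  proof (rule sum_mono)
    fix Q assume "Q \<in> F"
    then obtain R where R: "R \<in> maximal_sets F" "Q \<subseteq> R"
      using maximal_set_above F(1) by blast
    then show "a Q \<le> (\<Sum>R\<in>maximal_sets F. a Q * of_bool (Q \<subseteq> R))"
      using member_le_sum[of R "maximal_sets F" "\<lambda>R. a Q * of_bool (Q \<subseteq> R)"] fin by simp
  qed
  also have "\<dots> = (\<Sum>R\<in>maximal_sets F. \<Sum>Q\<in>F. a Q * of_bool (Q \<subseteq> R))"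
    by (rule sum.swap)
  also have "\<dots> = (\<Sum>R\<in>maximal_sets F. \<Sum>Q\<in>{Q\<in>F. Q \<subseteq> R}. a Q)"
    using F(1) by (intro sum.cong refl sum.mono_neutral_cong_right) auto
  also have "\<dots> \<le> (\<Sum>R\<in>maximal_sets F. C * emeasure M R)"
    using maximal_sets_subset[of F] by (intro sum_mono carleson) auto
  also have "\<dots> = C * emeasure M (\<Union>F)"
    by (simp add: emeasure_Union_nested[OF F] sum_distrib_left)
  finally show ?thesis .
qed

text \<open>
  Decompose \<open>\<phi> Q\<close> into its layers. The layer at level \<open>t\<close> contributes the coefficients of the
  members with \<open>\<phi> Q \<ge> t\<close>, whose union is the level set \<open>{finmax F \<phi> \<ge> t}\<close>, and on this union the
  Carleson condition is available. Reassembling the layers gives the integral of the maximal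
  function.
\<close>

lemma carleson_embedding_finite:
  fixes a :: "'a set \<Rightarrow> ennreal"
  assumes F: "finite F" "nested F" "\<And>Q. Q \<in> F \<Longrightarrow> Q \<in> sets M"
    and \<phi>: "\<And>Q. Q \<in> F \<Longrightarrow> 0 \<le> \<phi> Q"
    and carleson: "\<And>R. R \<in> F \<Longrightarrow> (\<Sum>Q\<in>{Q\<in>F. Q \<subseteq> R}. a Q) \<le> C * emeasure M R"
  shows "(\<Sum>Q\<in>F. a Q * ennreal (\<phi> Q)) \<le> C * (\<integral>\<^sup>+ x. ennreal (finmax F \<phi> x) \<partial>M)"
proof -
  obtain k l where l: "enumerates k l (\<phi> ` F)"
    using ex_enumerates[of "\<phi> ` F"] F(1) \<phi> by blast
  define \<delta> where "\<delta> j = ennreal (l j - l (j - 1))" for j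
  have id: "mono_on {0..} (\<lambda>t::real. t)" by (simp add: mono_on_def)
  have U [measurable]: "level_union F \<phi> t \<in> sets M" for t
    using F by (intro sets_level_union) auto
  have level: "(\<Sum>Q\<in>F. a Q * of_bool (t \<le> \<phi> Q)) \<le> C * emeasure M (level_union F \<phi> t)" for t
  proof -
    have "(\<Sum>Q\<in>F. a Q * of_bool (t \<le> \<phi> Q)) = (\<Sum>Q\<in>{Q\<in>F. t \<le> \<phi> Q}. a Q)"
      using F(1) by (intro sum.mono_neutral_cong_right) auto
    also have "\<dots> \<le> C * emeasure M (\<Union>{Q\<in>F. t \<le> \<phi> Q})"
    proof (rule carleson_Union)
      fix R assume "R \<in> {Q\<in>F. t \<le> \<phi> Q}"
      then have "(\<Sum>Q\<in>{Q\<in>F. Q \<subseteq> R}. a Q) \<le> C * emeasure M R" by (intro carleson) simp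
      moreover have "(\<Sum>Q\<in>{Q \<in> {Q\<in>F. t \<le> \<phi> Q}. Q \<subseteq> R}. a Q) \<le> (\<Sum>Q\<in>{Q\<in>F. Q \<subseteq> R}. a Q)"
        using F(1) by (intro sum_mono2) auto
      ultimately show "(\<Sum>Q\<in>{Q \<in> {Q\<in>F. t \<le> \<phi> Q}. Q \<subseteq> R}. a Q) \<le> C * emeasure M R" by simp
    qed (use F nested_subset[OF F(2)] in auto)
    finally show ?thesis by (simp add: level_union_def)
  qed
  have int: "(\<integral>\<^sup>+ x. ennreal (finmax F \<phi> x) \<partial>M) = (\<Sum>j=1..k. \<delta> j * emeasure M (level_union F \<phi> (l j)))"
    unfolding \<delta>_def by (rule layer_cake_integral[OF F(1,3) l id refl])
  have "(\<Sum>Q\<in>F. a Q * ennreal (\<phi> Q)) = (\<Sum>Q\<in>F. \<Sum>j=1..k. \<delta> j * (a Q * of_bool (l j \<le> \<phi> Q)))"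
    using layer_cake_value[OF l _ id]
    by (simp add: \<delta>_def sum_distrib_left mult_ac del: sum_mult_of_bool_eq sum_of_bool_mult_eq)
  also have "\<dots> = (\<Sum>j=1..k. \<delta> j * (\<Sum>Q\<in>F. a Q * of_bool (l j \<le> \<phi> Q)))"
    by (subst sum.swap) (simp add: sum_distrib_left)
  also have "\<dots> \<le> (\<Sum>j=1..k. \<delta> j * (C * emeasure M (level_union F \<phi> (l j))))"
    by (intro sum_mono mult_left_mono level) simp
  also have "\<dots> = C * (\<integral>\<^sup>+ x. ennreal (finmax F \<phi> x) \<partial>M)"
    unfolding int by (simp add: sum_distrib_left mult_ac)
  finally show ?thesis .
qed

section \<open>Doob's maximal inequality for finite nested families\<close>

text \<open>
  Since \<open>d(u^p) = p / (p - 1) * u * d(u^(p-1))\<close>, the left-hand side is the integral of the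
  right-hand expression with a varying factor \<open>u\<close> between \<open>s\<close> and \<open>t\<close>; replacing it by \<open>t\<close> only
  increases the integral. After clearing denominators this is Young's inequality for \<open>t\<close> and
  \<open>s powr (p - 1)\<close>.
\<close>

lemma powr_increment_bound:
  fixes p s t :: real
  assumes "1 < p" "0 \<le> s" "0 \<le> t"
  shows "t powr p - s powr p \<le> p / (p - 1) * (t powr (p - 1) - s powr (p - 1)) * t"
proof -
  have "t * s powr (p - 1) \<le> t powr p / p + (s powr (p - 1)) powr (p / (p - 1)) / (p / (p - 1))"
    using assms by (intro Youngs_inequality) (auto simp: field_simps)
  also have "(s powr (p - 1)) powr (p / (p - 1)) = s powr p"
    using assms by (simp add: powr_powr)
  finally have "p * (t * s powr (p - 1)) \<le> t powr p + (p - 1) * s powr p"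
    using assms by (simp add: field_simps)
  moreover have "t powr p = t powr (p - 1) * t"
    using assms powr_add[of t "p - 1" 1] by (cases "t = 0") auto
  ultimately show ?thesis
    using assms by (simp add: field_simps)
qed

text \<open>
  Finiteness of \<open>X\<close> is essential, because a multiple of \<open>X\<close> is subtracted from both sides.
\<close>

lemma absorb_young:
  fixes X Y :: ennreal
  assumes "1 < p" "X < \<infinity>" "X \<le> ennreal (c / p) * Y + ennreal (1 - 1 / p) * X" "0 < c"
  shows "X \<le> ennreal c * Y"
proof (cases Y)
  case (real y)
  obtain x where x: "X = ennreal x" "0 \<le> x"
    using assms(2) by (cases X) auto
  have "ennreal x \<le> ennreal (c / p * y + (1 - 1 / p) * x)"
    using assms(1,3,4) real x ennreal_mult[of "c / p" y] ennreal_mult[of "1 - 1 / p" x]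
    by (simp add: ennreal_plus)
  then have "x \<le> c / p * y + (1 - 1 / p) * x"
    using assms real x by (subst (asm) ennreal_le_iff) auto
  then have "x \<le> c * y"
    using assms by (simp add: field_simps)
  then show ?thesis
    using assms real x by (simp add: ennreal_leI flip: ennreal_mult)
qed (use assms in \<open>simp add: ennreal_mult_top\<close>)

text \<open>
  The numbers \<open>\<phi> Q\<close> stand for averages of \<open>f\<close>. The level set \<open>U\<close> at level \<open>t\<close> is the disjoint union
  of members on which the average is at least \<open>t\<close>, which gives the weak-type bound
  \<open>t * \<mu> U \<le> \<integral>\<^sub>U f\<close>. Summing the layers of \<open>finmax^p\<close> and trading each increment of \<open>t^p\<close> for
  \<open>q * t\<close> times an increment of \<open>t^(p-1)\<close>, where \<open>q = p / (p - 1)\<close>, yields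
  \<open>\<integral> finmax^p \<le> \<integral> q * f * finmax^(p-1)\<close>. Young's inequality bounds the integrand by
  \<open>(q * f)^p / p + finmax^p / q\<close>, and the last term is absorbed into the left-hand side; this gives
  the same constant as Hoelder's inequality followed by a division.
\<close>

lemma doob_finite:
  fixes f :: "'a \<Rightarrow> real"
  assumes p: "1 < p"
    and F: "finite F" "nested F" "\<And>Q. Q \<in> F \<Longrightarrow> Q \<in> sets M" "\<And>Q. Q \<in> F \<Longrightarrow> emeasure M Q < \<infinity>"
    and f [measurable]: "f \<in> borel_measurable M" and f0: "\<And>x. 0 \<le> f x"
    and \<phi>: "\<And>Q. Q \<in> F \<Longrightarrow> 0 \<le> \<phi> Q"
    and avg: "\<And>Q. Q \<in> F \<Longrightarrow> ennreal (\<phi> Q) * emeasure M Q \<le> (\<integral>\<^sup>+ x\<in>Q. ennreal (f x) \<partial>M)"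
  shows "(\<integral>\<^sup>+ x. ennreal (finmax F \<phi> x powr p) \<partial>M)
           \<le> ennreal ((p / (p - 1)) powr p) * (\<integral>\<^sup>+ x. ennreal (f x powr p) \<partial>M)"
proof -
  define q where "q = p / (p - 1)"
  have q: "1 < q" "1 / p + 1 / q = 1" using p by (auto simp: q_def field_simps)
  have q_inv: "1 / q = 1 - 1 / p" using q(2) by simp
  obtain k l where l: "enumerates k l (\<phi> ` F)"
    using ex_enumerates[of "\<phi> ` F"] F(1) \<phi> by blast
  have mono: "mono_on {0..} (\<lambda>t::real. t powr r)" if "0 < r" for r
    using that by (auto simp: mono_on_def intro!: powr_mono2)
  define U where "U j = level_union F \<phi> (l j)" for j
  have U [measurable]: "U j \<in> sets M" for j
    unfolding U_def using F by (intro sets_level_union) auto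
  \<comment> \<open>The weak-type bound, first on the maximal members and then on their disjoint union.\<close>
  have weak: "ennreal (l j) * emeasure M (U j) \<le> (\<integral>\<^sup>+ x\<in>U j. ennreal (f x) \<partial>M)" if "1 \<le> j" "j \<le> k" for j
  proof -
    let ?G = "{Q\<in>F. l j \<le> \<phi> Q}"
    have G: "finite ?G" "nested ?G" "\<And>Q. Q \<in> ?G \<Longrightarrow> Q \<in> sets M"
      using F nested_subset[OF F(2), of ?G] by auto
    have "ennreal (l j) * emeasure M (U j) = (\<Sum>R\<in>maximal_sets ?G. ennreal (l j) * emeasure M R)"
      unfolding U_def level_union_def sum_distrib_left[symmetric]
      by (intro arg_cong[where f = "(*) _"] emeasure_Union_nested G)
    also have "\<dots> \<le> (\<Sum>R\<in>maximal_sets ?G. \<integral>\<^sup>+ x\<in>R. ennreal (f x) \<partial>M)"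
    proof (rule sum_mono)
      fix R assume "R \<in> maximal_sets ?G"
      then have R: "R \<in> F" "l j \<le> \<phi> R" using maximal_sets_subset by auto
      then have "ennreal (l j) * emeasure M R \<le> ennreal (\<phi> R) * emeasure M R"
        by (intro mult_right_mono ennreal_leI) auto
      with avg[OF R(1)] show "ennreal (l j) * emeasure M R \<le> (\<integral>\<^sup>+ x\<in>R. ennreal (f x) \<partial>M)"
        by simp
    qed
    also have "\<dots> = (\<integral>\<^sup>+ x\<in>U j. ennreal (f x) \<partial>M)"
      unfolding U_def level_union_def by (rule nn_integral_Union_nested[OF G, symmetric]) auto
    finally show ?thesis .
  qed
  have Ufin: "emeasure M (U j) < \<infinity>" for j
  proof -
    have "emeasure M (U j) \<le> emeasure M (\<Union>F)"
      using F by (intro emeasure_mono sets.finite_Union) (auto simp: U_def level_union_def)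
    also have "\<dots> = (\<Sum>R\<in>maximal_sets F. emeasure M R)"
      by (rule emeasure_Union_nested) (use F in auto)
    also have "\<dots> < \<infinity>"
      using F(4) maximal_sets_subset[of F] F(1)
      by (auto simp: less_top[symmetric] ennreal_sum_less_top finite_subset)
    finally show ?thesis .
  qed
  define X where "X = (\<integral>\<^sup>+ x. ennreal (finmax F \<phi> x powr p) \<partial>M)"
  define Y where "Y = (\<integral>\<^sup>+ x. ennreal (f x powr p) \<partial>M)"
  have Xeq: "X = (\<Sum>j=1..k. ennreal (l j powr p - l (j - 1) powr p) * emeasure M (U j))"
    unfolding X_def U_def using p by (intro layer_cake_integral[OF F(1,3) l mono]) auto
  \<comment> \<open>Finiteness is what permits absorbing a multiple of \<open>X\<close> at the end.\<close>
  then have Xfin: "X < \<infinity>"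
    using Ufin by (auto simp: ennreal_mult_less_top)
  have meas [measurable]: "finmax F \<phi> \<in> borel_measurable M"
    by (rule borel_measurable_finmax) (use F in auto)
  have "X \<le> (\<Sum>j=1..k. ennreal (q * (l j powr (p - 1) - l (j - 1) powr (p - 1)))
                  * (ennreal (l j) * emeasure M (U j)))"
    unfolding Xeq
  proof (rule sum_mono)
    fix j assume "j \<in> {1..k}"
    then have j: "0 \<le> l (j - 1)" "l (j - 1) < l j" using enumerates_incr[OF l, of j] by auto
    have "ennreal (l j powr p - l (j - 1) powr p)
        \<le> ennreal (q * (l j powr (p - 1) - l (j - 1) powr (p - 1)) * l j)"
      unfolding q_def using p j by (intro ennreal_leI powr_increment_bound) auto
    also have "\<dots> = ennreal (q * (l j powr (p - 1) - l (j - 1) powr (p - 1))) * ennreal (l j)"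
      using j by (intro ennreal_mult'') auto
    finally show "ennreal (l j powr p - l (j - 1) powr p) * emeasure M (U j)
        \<le> ennreal (q * (l j powr (p - 1) - l (j - 1) powr (p - 1))) * (ennreal (l j) * emeasure M (U j))"
      by (simp add: mult_right_mono flip: mult.assoc)
  qed
  also have "\<dots> \<le> (\<Sum>j=1..k. ennreal (q * (l j powr (p - 1) - l (j - 1) powr (p - 1)))
                  * (\<integral>\<^sup>+ x\<in>U j. ennreal (f x) \<partial>M))"
    by (intro sum_mono mult_left_mono weak) auto
  also have "\<dots> = (\<integral>\<^sup>+ x. (\<Sum>j=1..k. ennreal (q * (l j powr (p - 1) - l (j - 1) powr (p - 1)))
                  * (ennreal (f x) * indicator (U j) x)) \<partial>M)"
    by (simp add: nn_integral_sum nn_integral_cmult)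
  also have "\<dots> = (\<integral>\<^sup>+ x. ennreal (q * f x * finmax F \<phi> x powr (p - 1)) \<partial>M)"
  proof (rule nn_integral_cong)
    fix x
    have "ennreal (q * f x * finmax F \<phi> x powr (p - 1))
        = ennreal (q * f x) * ennreal (finmax F \<phi> x powr (p - 1))"
      using q f0[of x] by (intro ennreal_mult) auto
    also have "ennreal (finmax F \<phi> x powr (p - 1))
        = (\<Sum>j=1..k. ennreal (l j powr (p - 1) - l (j - 1) powr (p - 1)) * indicator (U j) x)"
      unfolding U_def using p by (intro layer_cake_finmax[OF F(1) l mono]) auto
    also have "ennreal (q * f x) * \<dots> = (\<Sum>j=1..k. ennreal (q * (l j powr (p - 1) - l (j - 1) powr (p - 1)))
                  * (ennreal (f x) * indicator (U j) x))"
      unfolding sum_distrib_left using q f0[of x] by (intro sum.cong) (auto simp: ennreal_mult' mult_ac)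
    finally show "(\<Sum>j=1..k. ennreal (q * (l j powr (p - 1) - l (j - 1) powr (p - 1)))
                  * (ennreal (f x) * indicator (U j) x)) = ennreal (q * f x * finmax F \<phi> x powr (p - 1))"
      by simp
  qed
  also have "\<dots> \<le> (\<integral>\<^sup>+ x. ennreal (q powr p / p) * ennreal (f x powr p)
                    + ennreal (1 - 1 / p) * ennreal (finmax F \<phi> x powr p) \<partial>M)"
  proof (rule nn_integral_mono)
    fix x
    have "q * f x * finmax F \<phi> x powr (p - 1)
        \<le> (q * f x) powr p / p + (finmax F \<phi> x powr (p - 1)) powr q / q"
      using p q f0[of x] by (intro Youngs_inequality) auto
    also have "(finmax F \<phi> x powr (p - 1)) powr q = finmax F \<phi> x powr p"
      using p by (simp add: powr_powr q_def)
    also have "(q * f x) powr p = q powr p * f x powr p"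
      using q f0[of x] by (simp add: powr_mult)
    also have "q powr p * f x powr p / p + finmax F \<phi> x powr p / q
        = q powr p / p * f x powr p + (1 - 1 / p) * finmax F \<phi> x powr p"
      unfolding q_inv[symmetric] by simp
    finally have "q * f x * finmax F \<phi> x powr (p - 1)
        \<le> q powr p / p * f x powr p + (1 - 1 / p) * finmax F \<phi> x powr p" .
    then have "ennreal (q * f x * finmax F \<phi> x powr (p - 1))
        \<le> ennreal (q powr p / p * f x powr p + (1 - 1 / p) * finmax F \<phi> x powr p)"
      by (rule ennreal_leI)
    also have "\<dots> = ennreal (q powr p / p) * ennreal (f x powr p)
                    + ennreal (1 - 1 / p) * ennreal (finmax F \<phi> x powr p)"
      using p ennreal_mult[of "q powr p / p" "f x powr p"]
        ennreal_mult[of "1 - 1 / p" "finmax F \<phi> x powr p"]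
      by (simp add: ennreal_plus)
    finally show "ennreal (q * f x * finmax F \<phi> x powr (p - 1)) \<le> \<dots>" .
  qed
  also have "\<dots> = ennreal (q powr p / p) * Y + ennreal (1 - 1 / p) * X"
    unfolding X_def Y_def using p by (simp add: nn_integral_add nn_integral_cmult meas)
  finally have "X \<le> ennreal (q powr p) * Y"
    by (intro absorb_young[OF p Xfin]) (use q in auto)
  then show ?thesis
    by (simp add: X_def Y_def q_def)
qed

section \<open>Cubes, weights and dyadic grids\<close>

lemma cube_between_boxes:
  fixes Q :: "(real ^ 'n) set"
  assumes "cube_of_side s Q"
  obtains a b where "box a b \<noteq> {}" "box a b \<subseteq> Q" "Q \<subseteq> cbox a b"
proof -
  obtain c I where s: "0 < s" and I: "\<And>i. {c $ i <..< c $ i + s} \<subseteq> I i" "\<And>i. I i \<subseteq> {c $ i .. c $ i + s}"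
    and Q: "Q = {x. \<forall>i. x $ i \<in> I i}"
    using assms unfolding cube_of_side_def by blast
  define b where "b = (\<chi> i. c $ i + s)"
  have "(\<chi> i. c $ i + s / 2) \<in> box c b"
    using s by (simp add: mem_box_cart b_def)
  moreover have "box c b \<subseteq> Q"
  proof
    fix x assume "x \<in> box c b"
    then have "x $ i \<in> {c $ i <..< c $ i + s}" for i
      by (simp add: mem_box_cart b_def)
    then show "x \<in> Q"
      unfolding Q using I(1) by (simp add: subset_iff)
  qed
  moreover have "Q \<subseteq> cbox c b"
  proof
    fix x assume "x \<in> Q"
    then have "x $ i \<in> {c $ i .. c $ i + s}" for i
      unfolding Q using I(2)[of i] by (simp add: subset_iff)
    then show "x \<in> cbox c b"
      by (simp add: mem_box_cart b_def)
  qed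
  ultimately show thesis
    using that by blast
qed

text \<open>
  Whatever faces belong to the cube, it differs from an open box only by a part of the boundary,
  which is a null set and hence Lebesgue measurable.
\<close>

lemma lmeasurable_cube:
  assumes "cube_of_side s Q"
  shows "Q \<in> lmeasurable"
proof -
  obtain a b where ab: "box a b \<noteq> {}" "box a b \<subseteq> Q" "Q \<subseteq> cbox a b"
    using cube_between_boxes[OF assms] .
  have "Q - box a b \<in> lmeasurable"
    by (rule negligible_imp_measurable, rule negligible_subset[OF negligible_frontier_interval[of a b]])
      (use ab in auto)
  then have "box a b \<union> (Q - box a b) \<in> lmeasurable"
    by (intro fmeasurable.Un) auto
  also have "box a b \<union> (Q - box a b) = Q"
    using ab(2) by blast
  finally show ?thesis .
qed

text \<open>
  Local integrability makes the restriction of \<open>w\<close> to every ball measurable, and \<open>w\<close> is the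
  pointwise limit of these restrictions.
\<close>

lemma borel_measurable_weight:
  fixes w :: "real ^ 'n \<Rightarrow> real"
  assumes "weight w"
  shows "w \<in> borel_measurable lebesgue"
proof (rule borel_measurable_LIMSEQ_real)
  show "(\<lambda>x. indicator (cball 0 (real n)) x *\<^sub>R w x) \<in> borel_measurable lebesgue" for n
  proof (rule borel_measurable_integrable)
    show "integrable lebesgue (\<lambda>x. indicator (cball 0 (real n)) x *\<^sub>R w x)"
      using assms by (simp add: weight_def set_integrable_def)
  qed
  show "(\<lambda>n. indicator (cball 0 (real n)) x *\<^sub>R w x) \<longlonglongrightarrow> w x" for x
  proof (rule tendsto_eventually)
    obtain N :: nat where "norm x \<le> real N" using real_arch_simple by blast
    then show "\<forall>\<^sub>F n in sequentially. indicator (cball 0 (real n)) x *\<^sub>R w x = w x"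
      by (intro eventually_sequentiallyI[of N]) auto
  qed
qed

text \<open>
  These two facts make the averages over cubes meaningful: the denominator of an average is a
  positive finite number.
\<close>

lemma weight_cube:
  fixes w :: "real ^ 'n \<Rightarrow> real"
  assumes w: "weight w" and Q: "cube_of_side s Q"
  shows "(\<integral>\<^sup>+ y\<in>Q. ennreal (w y) \<partial>lebesgue) \<noteq> 0" "(\<integral>\<^sup>+ y\<in>Q. ennreal (w y) \<partial>lebesgue) < \<infinity>"
proof -
  have [measurable]: "w \<in> borel_measurable lebesgue" "Q \<in> sets lebesgue"
    using borel_measurable_weight[OF w] lmeasurable_cube[OF Q] by auto
  obtain a b where ab: "box a b \<noteq> {}" "box a b \<subseteq> Q" "Q \<subseteq> cbox a b"
    using cube_between_boxes[OF Q] .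
  have "set_integrable lebesgue (cbox a b) w"
    using w by (simp add: weight_def)
  then have "(\<integral>\<^sup>+ y. ennreal (norm (indicator (cbox a b) y *\<^sub>R w y)) \<partial>lebesgue) < \<infinity>"
    unfolding set_integrable_def integrable_iff_bounded by simp
  moreover have "(\<integral>\<^sup>+ y\<in>Q. ennreal (w y) \<partial>lebesgue)
      \<le> (\<integral>\<^sup>+ y. ennreal (norm (indicator (cbox a b) y *\<^sub>R w y)) \<partial>lebesgue)"
  proof (rule nn_integral_mono)
    fix y
    show "ennreal (w y) * indicator Q y \<le> ennreal (norm (indicator (cbox a b) y *\<^sub>R w y))"
      using ab(3) by (cases "y \<in> Q") (auto intro!: ennreal_leI)
  qed
  ultimately show "(\<integral>\<^sup>+ y\<in>Q. ennreal (w y) \<partial>lebesgue) < \<infinity>"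
    by (rule le_less_trans[rotated])
  show "(\<integral>\<^sup>+ y\<in>Q. ennreal (w y) \<partial>lebesgue) \<noteq> 0"
  proof
    assume "(\<integral>\<^sup>+ y\<in>Q. ennreal (w y) \<partial>lebesgue) = 0"
    then have "AE y in lebesgue. ennreal (w y) * indicator Q y = 0"
      by (subst (asm) nn_integral_0_iff_AE) auto
    moreover have "AE y in lebesgue. w y > 0"
      using w by (simp add: weight_def)
    ultimately have "AE y in lebesgue. y \<notin> Q"
      by eventually_elim (auto simp: indicator_def)
    then have "negligible Q"
      unfolding negligible_iff_null_sets by (subst AE_iff_null_sets) auto
    then have "negligible (box a b)"
      using ab(2) by (rule negligible_subset)
    with open_not_negligible[OF open_box ab(1)] show False ..
  qed
qed

context
  fixes D :: "(real ^ 'n) set set"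
  assumes D: "dyadic_grid D"
begin

lemma partition_dyadic_grid: "partition_on UNIV {Q\<in>D. cube_of_side (2 powi k) Q}"
  using D[unfolded dyadic_grid_def, THEN conjunct2, THEN conjunct2] by (rule spec)

lemma dyadic_cube: "Q \<in> D \<Longrightarrow> \<exists>s. cube_of_side s Q"
  using D by (auto simp: dyadic_grid_def)

lemma nested_dyadic_grid: "nested D"
  using D by (simp add: dyadic_grid_def nested_def)

lemma sets_dyadic_grid: "Q \<in> D \<Longrightarrow> Q \<in> sets lebesgue"
  using dyadic_cube lmeasurable_cube by (blast intro: fmeasurableD)

lemma dyadic_grid_nonempty: "D \<noteq> {}"
proof -
  have "partition_on UNIV {Q\<in>D. cube_of_side (2 powi 0) Q}"
    by (rule partition_dyadic_grid)
  then have "\<Union>{Q\<in>D. cube_of_side (2 powi 0) Q} = UNIV"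
    by (simp add: partition_on_def)
  then show ?thesis
    by auto
qed

text \<open>
  The cubes of one generation are disjoint with nonempty interior, hence countably many.
\<close>

lemma countable_dyadic_grid: "countable D"
proof -
  have "countable {Q\<in>D. cube_of_side (2 powi k) Q}" for k
  proof (rule countable_disjoint_nonempty_interior_subsets)
    show "pairwise disjnt {Q\<in>D. cube_of_side (2 powi k) Q}"
      using partition_dyadic_grid[of k] by (simp add: partition_on_def)
    fix S assume S: "S \<in> {Q\<in>D. cube_of_side (2 powi k) Q}" "interior S = {}"
    then have "cube_of_side (2 powi k) S" by simp
    then obtain a b where "box a b \<noteq> {}" "box a b \<subseteq> S"
      by (rule cube_between_boxes)
    then show "S = {}"
      using interior_maximal[of "box a b" S] S(2) by (simp add: open_box)
  qed
  then have "countable (\<Union>k::int. {Q\<in>D. cube_of_side (2 powi k) Q})"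
    by simp
  moreover have "D \<subseteq> (\<Union>k::int. {Q\<in>D. cube_of_side (2 powi k) Q})"
    using D by (auto simp: dyadic_grid_def)
  ultimately show ?thesis
    by (rule countable_subset[rotated])
qed

lemma borel_measurable_dyadic_sup:
  fixes c :: "(real ^ 'n) set \<Rightarrow> ennreal"
  shows "(\<lambda>x. SUP Q\<in>{Q\<in>D. x \<in> Q}. c Q) \<in> borel_measurable lebesgue"
proof -
  have eq: "(SUP Q\<in>{Q\<in>D. x \<in> Q}. c Q) = (SUP Q\<in>D. c Q * indicator Q x)" for x
  proof (rule antisym)
    show "(SUP Q\<in>{Q\<in>D. x \<in> Q}. c Q) \<le> (SUP Q\<in>D. c Q * indicator Q x)"
      by (rule SUP_mono) (auto intro!: bexI)
    show "(SUP Q\<in>D. c Q * indicator Q x) \<le> (SUP Q\<in>{Q\<in>D. x \<in> Q}. c Q)"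
      by (rule SUP_least) (auto simp: indicator_def intro: SUP_upper)
  qed
  show ?thesis
    unfolding eq using countable_dyadic_grid sets_dyadic_grid by (intro borel_measurable_SUP) auto
qed

end

text \<open>
  Since \<open>\<bar>f\<bar> \<le> 1 + \<bar>f\<bar>^q\<close>, the numerator is at most the weight of the cube plus the \<open>q\<close>-th power of
  the norm of \<open>f\<close> in \<open>L^q(w)\<close>.
\<close>

lemma weighted_avg_finite:
  fixes w :: "real ^ 'n \<Rightarrow> real"
  assumes w: "weight w" and Q: "cube_of_side s Q" and q: "1 < q" and f: "in_weighted_Lp q w f"
  shows "weighted_avg w f Q < \<infinity>"
proof -
  have [measurable]: "w \<in> borel_measurable lebesgue" "Q \<in> sets lebesgue" "f \<in> borel_measurable lebesgue"
    using borel_measurable_weight[OF w] lmeasurable_cube[OF Q] f by (auto simp: in_weighted_Lp_def)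
  have fin: "(\<integral>\<^sup>+ x. ennreal (cmod (f x) powr q) * ennreal (w x) \<partial>lebesgue) < \<infinity>"
    using f by (simp add: in_weighted_Lp_def weighted_norm_def less_top[symmetric] enn_powr_eq_top_iff enn_powr_ennreal)
  have "(\<integral>\<^sup>+ y\<in>Q. ennreal (cmod (f y) * w y) \<partial>lebesgue)
      \<le> (\<integral>\<^sup>+ y. ennreal (w y) * indicator Q y + ennreal (cmod (f y) powr q) * ennreal (w y) \<partial>lebesgue)"
  proof (rule nn_integral_mono)
    fix y
    have "cmod (f y) \<le> 1 + cmod (f y) powr q"
    proof (cases "cmod (f y) \<le> 1")
      case False
      then have "cmod (f y) powr 1 \<le> cmod (f y) powr q"
        using q by (intro powr_mono) auto
      then show ?thesis using False by simp
    qed (simp add: add_increasing2)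
    then have "ennreal (cmod (f y)) \<le> 1 + ennreal (cmod (f y) powr q)"
      using ennreal_leI[of "cmod (f y)" "1 + cmod (f y) powr q"] by simp
    then have "ennreal (cmod (f y)) * ennreal (w y) \<le> (1 + ennreal (cmod (f y) powr q)) * ennreal (w y)"
      by (rule mult_right_mono) simp
    then show "ennreal (cmod (f y) * w y) * indicator Q y
        \<le> ennreal (w y) * indicator Q y + ennreal (cmod (f y) powr q) * ennreal (w y)"
      by (auto simp: indicator_def ennreal_mult' distrib_right)
  qed
  also have "\<dots> = (\<integral>\<^sup>+ y\<in>Q. ennreal (w y) \<partial>lebesgue)
      + (\<integral>\<^sup>+ x. ennreal (cmod (f x) powr q) * ennreal (w x) \<partial>lebesgue)"
    by (rule nn_integral_add) auto
  also have "\<dots> < \<infinity>"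
    using fin weight_cube(2)[OF w Q] by simp
  finally show ?thesis
    using weight_cube(1)[OF w Q]
    unfolding weighted_avg_def infinity_ennreal_def less_top[symmetric] ennreal_divide_eq_top_iff by blast
qed

section \<open>The dyadic maximal function of one weight\<close>

text \<open>
  Doob's inequality for the measure with density \<open>w\<close>, passed from the first \<open>n\<close> cubes of an
  enumeration of the grid to the whole grid by monotone convergence.
\<close>

lemma weighted_dyadic_maximal_bound:
  fixes w :: "real ^ 'n \<Rightarrow> real"
  assumes D: "dyadic_grid D" and w: "weight w" and q: "1 < q" and f: "in_weighted_Lp q w f"
  shows "weighted_norm q w (\<lambda>x. SUP Q\<in>{Q\<in>D. x \<in> Q}. weighted_avg w f Q)
    \<le> ennreal (conj_exponent q) * weighted_norm q w (\<lambda>x. ennreal (cmod (f x)))"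
proof -
  have meas [measurable]: "w \<in> borel_measurable lebesgue" "f \<in> borel_measurable lebesgue"
    using borel_measurable_weight[OF w] f by (auto simp: in_weighted_Lp_def)
  have div: "x / y * y = x" if "y \<noteq> 0" "y < top" for x y :: ennreal
    by (metis ennreal_divide_times ennreal_divide_self mult.right_neutral that)
  define M where "M = density lebesgue (\<lambda>x. ennreal (w x))"
  have sets_M [measurable_cong]: "sets M = sets lebesgue" by (simp add: M_def)
  have int_M: "(\<integral>\<^sup>+ x. g x \<partial>M) = (\<integral>\<^sup>+ x. g x * ennreal (w x) \<partial>lebesgue)"
    if "g \<in> borel_measurable lebesgue" for g
    unfolding M_def using that by (subst nn_integral_density) (auto simp: mult.commute)
  have em_M: "emeasure M Q = (\<integral>\<^sup>+ y\<in>Q. ennreal (w y) \<partial>lebesgue)" if "Q \<in> sets lebesgue" for Q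
    unfolding M_def using that by (subst emeasure_density) auto
  define \<phi> where "\<phi> Q = enn2real (weighted_avg w f Q)" for Q
  have \<phi>: "ennreal (\<phi> Q) = weighted_avg w f Q" if "Q \<in> D" for Q
    using dyadic_cube[OF D that] weighted_avg_finite[OF w _ q f] by (auto simp: \<phi>_def)
  define e where "e = from_nat_into D"
  have e: "range e = D"
    unfolding e_def using D by (intro range_from_nat_into dyadic_grid_nonempty countable_dyadic_grid)
  \<comment> \<open>An increasing exhaustion of the grid by finite families, which need not respect the generations of cubes.\<close>
  define F where "F n = e ` {..n}" for n
  have F: "finite (F n)" "F n \<subseteq> D" for n
    using e by (auto simp: F_def)
  have Fmono: "F n \<subseteq> F m" if "n \<le> m" for n m
    using that by (auto simp: F_def)
  have FD: "D = (\<Union>n. F n)"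
    using e by (auto simp: F_def)
  let ?G = "\<lambda>n x. ennreal (finmax (F n) \<phi> x)"
  have G: "?G n x = (SUP Q\<in>{Q\<in>F n. x \<in> Q}. weighted_avg w f Q)" for n x
    using F[of n] \<phi> by (subst ennreal_finmax) (auto simp: \<phi>_def[of "_::(real^'n) set"] intro!: SUP_cong)
  have sup: "(SUP Q\<in>{Q\<in>D. x \<in> Q}. weighted_avg w f Q) = (SUP n. ?G n x)" for x
  proof -
    have "{Q\<in>D. x \<in> Q} = (\<Union>n. {Q\<in>F n. x \<in> Q})" using FD by auto
    then show ?thesis by (simp add: G SUP_UNION)
  qed
  have inc: "incseq (\<lambda>n x. enn_powr (?G n x) q)"
  proof (rule incseq_SucI, rule le_funI)
    fix n x
    show "enn_powr (?G n x) q \<le> enn_powr (?G (Suc n) x) q"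
      unfolding G using q Fmono[of n "Suc n"] by (intro enn_powr_mono SUP_subset_mono) auto
  qed
  have [measurable]: "finmax (F n) \<phi> \<in> borel_measurable lebesgue" for n
    using F[of n] sets_dyadic_grid[OF D] by (intro borel_measurable_finmax) auto
  let ?N = "\<integral>\<^sup>+ x. enn_powr (ennreal (cmod (f x))) q * ennreal (w x) \<partial>lebesgue"
  have bound: "(\<integral>\<^sup>+ x. enn_powr (?G n x) q \<partial>M) \<le> ennreal (conj_exponent q powr q) * ?N" for n
  proof -
    have "(\<integral>\<^sup>+ x. ennreal (finmax (F n) \<phi> x powr q) \<partial>M)
        \<le> ennreal ((q / (q - 1)) powr q) * (\<integral>\<^sup>+ x. ennreal (cmod (f x) powr q) \<partial>M)"
    proof (rule doob_finite[OF q F(1)])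
      show "nested (F n)"
        using nested_subset[OF nested_dyadic_grid[OF D] F(2)] .
      show "(\<lambda>x. cmod (f x)) \<in> borel_measurable M"
        by measurable
      fix Q assume "Q \<in> F n"
      then have QD: "Q \<in> D" using F(2) by blast
      then obtain s where s: "cube_of_side s Q" using dyadic_cube[OF D] by blast
      show QM: "Q \<in> sets M" using sets_dyadic_grid[OF D QD] by (simp add: sets_M)
      have Q [measurable]: "Q \<in> sets lebesgue" using sets_dyadic_grid[OF D QD] .
      show "emeasure M Q < \<infinity>"
        using weight_cube(2)[OF w s] by (simp add: em_M[OF Q])
      show "0 \<le> \<phi> Q" by (simp add: \<phi>_def)
      have "ennreal (\<phi> Q) * emeasure M Q = (\<integral>\<^sup>+ y\<in>Q. ennreal (cmod (f y) * w y) \<partial>lebesgue)"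
        unfolding \<phi>[OF QD] em_M[OF Q] weighted_avg_def
        using weight_cube[OF w s] by (intro div) auto
      also have "\<dots> = (\<integral>\<^sup>+ x\<in>Q. ennreal (cmod (f x)) \<partial>M)"
        by (subst int_M) (auto simp: ennreal_mult' ennreal_mult'' mult_ac intro!: nn_integral_cong)
      finally show "ennreal (\<phi> Q) * emeasure M Q \<le> (\<integral>\<^sup>+ x\<in>Q. ennreal (cmod (f x)) \<partial>M)"
        by simp
    qed simp
    then show ?thesis
      using finmax_nonneg[OF F(1)]
      by (simp add: enn_powr_ennreal conj_exponent_def int_M)
  qed
  have "(\<integral>\<^sup>+ x. enn_powr (SUP Q\<in>{Q\<in>D. x \<in> Q}. weighted_avg w f Q) q * ennreal (w x) \<partial>lebesgue)
      = (\<integral>\<^sup>+ x. (SUP n. enn_powr (?G n x) q) \<partial>M)"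
    unfolding sup using q by (subst int_M) (auto simp: enn_powr_SUP)
  also have "\<dots> = (SUP n. \<integral>\<^sup>+ x. enn_powr (?G n x) q \<partial>M)"
    using inc by (rule nn_integral_monotone_convergence_SUP) measurable
  also have "\<dots> \<le> ennreal (conj_exponent q powr q) * ?N"
    by (rule SUP_least) (rule bound)
  finally have "weighted_norm q w (\<lambda>x. SUP Q\<in>{Q\<in>D. x \<in> Q}. weighted_avg w f Q)
      \<le> enn_powr (ennreal (conj_exponent q powr q) * ?N) (1 / q)"
    unfolding weighted_norm_def using q by (intro enn_powr_mono) auto
  also have "\<dots> = ennreal (conj_exponent q) * weighted_norm q w (\<lambda>x. ennreal (cmod (f x)))"
    using q by (simp add: weighted_norm_def enn_powr_mult enn_powr_ennreal powr_powr conj_exponent_def)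
  finally show ?thesis .
qed

section \<open>Multilinear Carleson embedding\<close>

text \<open>
  The sum over \<open>D\<close> is the supremum of its finite partial sums, and each of these is bounded by the
  finite embedding; enlarging the finite family to \<open>D\<close> only increases the maximal function.
\<close>

lemma dyadic_carleson_embedding:
  fixes D :: "(real ^ 'n) set set" and w :: "real ^ 'n \<Rightarrow> real" and a :: "(real ^ 'n) set \<Rightarrow> ennreal"
  assumes D: "dyadic_grid D" and w [measurable]: "w \<in> borel_measurable lebesgue"
    and carleson: "\<And>R. R \<in> D \<Longrightarrow>
      (\<Sum>\<^sub>\<infinity>Q\<in>{Q\<in>D. Q \<subseteq> R}. a Q) \<le> C * (\<integral>\<^sup>+ x\<in>R. ennreal (w x) \<partial>lebesgue)"
    and c: "\<And>Q. Q \<in> D \<Longrightarrow> c Q < \<infinity>"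
  shows "(\<Sum>\<^sub>\<infinity>Q\<in>D. a Q * c Q)
    \<le> C * (\<integral>\<^sup>+ x. (SUP Q\<in>{Q\<in>D. x \<in> Q}. c Q) * ennreal (w x) \<partial>lebesgue)"
proof -
  define M where "M = density lebesgue (\<lambda>x. ennreal (w x))"
  have "(\<Sum>\<^sub>\<infinity>Q\<in>D. a Q * c Q) = (SUP F\<in>{F. finite F \<and> F \<subseteq> D}. \<Sum>Q\<in>F. a Q * c Q)"
    by (rule nonneg_infsum_complete) simp
  also have "\<dots> \<le> C * (\<integral>\<^sup>+ x. (SUP Q\<in>{Q\<in>D. x \<in> Q}. c Q) * ennreal (w x) \<partial>lebesgue)"
  proof (rule SUP_least)
    fix F assume "F \<in> {F. finite F \<and> F \<subseteq> D}"
    then have F: "finite F" "F \<subseteq> D" by auto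
    define \<phi> where "\<phi> Q = enn2real (c Q)" for Q
    have \<phi>: "ennreal (\<phi> Q) = c Q" if "Q \<in> F" for Q
      using c[of Q] that F(2) by (auto simp: \<phi>_def)
    have sets: "Q \<in> sets lebesgue" if "Q \<in> F" for Q
      using sets_dyadic_grid[OF D] that F(2) by blast
    have [measurable]: "finmax F \<phi> \<in> borel_measurable lebesgue"
      by (rule borel_measurable_finmax[OF F(1) sets])
    have "(\<Sum>Q\<in>F. a Q * c Q) = (\<Sum>Q\<in>F. a Q * ennreal (\<phi> Q))"
      by (intro sum.cong) (auto simp: \<phi>)
    also have "\<dots> \<le> C * (\<integral>\<^sup>+ x. ennreal (finmax F \<phi> x) \<partial>M)"
    proof (rule carleson_embedding_finite[OF F(1)])
      show "nested F"
        using nested_subset[OF nested_dyadic_grid[OF D] F(2)] .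
      show "Q \<in> sets M" if "Q \<in> F" for Q
        using sets[OF that] by (simp add: M_def)
      show "0 \<le> \<phi> Q" for Q by (simp add: \<phi>_def)
      fix R assume R: "R \<in> F"
      then have "R \<in> D" using F(2) by blast
      have "(\<Sum>Q\<in>{Q\<in>F. Q \<subseteq> R}. a Q) \<le> (\<Sum>\<^sub>\<infinity>Q\<in>{Q\<in>D. Q \<subseteq> R}. a Q)"
        using F by (subst nonneg_infsum_complete) (auto intro!: SUP_upper)
      also have "\<dots> \<le> C * (\<integral>\<^sup>+ x\<in>R. ennreal (w x) \<partial>lebesgue)"
        using \<open>R \<in> D\<close> by (rule carleson)
      also have "(\<integral>\<^sup>+ x\<in>R. ennreal (w x) \<partial>lebesgue) = emeasure M R"
        unfolding M_def using sets[OF R] by (subst emeasure_density) auto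
      finally show "(\<Sum>Q\<in>{Q\<in>F. Q \<subseteq> R}. a Q) \<le> C * emeasure M R" .
    qed
    also have "(\<integral>\<^sup>+ x. ennreal (finmax F \<phi> x) \<partial>M)
        = (\<integral>\<^sup>+ x. ennreal (finmax F \<phi> x) * ennreal (w x) \<partial>lebesgue)"
      unfolding M_def by (subst nn_integral_density) (auto simp: mult.commute)
    also have "\<dots> \<le> (\<integral>\<^sup>+ x. (SUP Q\<in>{Q\<in>D. x \<in> Q}. c Q) * ennreal (w x) \<partial>lebesgue)"
    proof (intro nn_integral_mono mult_right_mono)
      fix x
      have "ennreal (finmax F \<phi> x) = (SUP Q\<in>{Q\<in>F. x \<in> Q}. ennreal (\<phi> Q))"
        by (rule ennreal_finmax[OF F(1)]) (simp add: \<phi>_def)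
      also have "\<dots> \<le> (SUP Q\<in>{Q\<in>D. x \<in> Q}. c Q)"
        using F(2) \<phi> by (intro SUP_subset_mono) auto
      finally show "ennreal (finmax F \<phi> x) \<le> (SUP Q\<in>{Q\<in>D. x \<in> Q}. c Q)" .
    qed simp
    finally show "(\<Sum>Q\<in>F. a Q * c Q)
        \<le> C * (\<integral>\<^sup>+ x. (SUP Q\<in>{Q\<in>D. x \<in> Q}. c Q) * ennreal (w x) \<partial>lebesgue)"
      by (simp add: mult_left_mono)
  qed
  finally show ?thesis .
qed

lemma dyadic_maximal_le_prod:
  "dyadic_maximal D m \<sigma> f x \<le> (\<Prod>i=1..m. SUP Q\<in>{Q\<in>D. x \<in> Q}. weighted_avg (\<sigma> i) (f i) Q)"
  unfolding dyadic_maximal_def by (intro SUP_least prod_mono_ennreal SUP_upper)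

lemma borel_measurable_nu_weight:
  assumes "\<And>i. i \<in> {1..m} \<Longrightarrow> \<sigma> i \<in> borel_measurable M"
  shows "nu_weight m p ps \<sigma> \<in> borel_measurable M"
proof -
  have "(\<lambda>x. \<Prod>i=1..m. \<sigma> i x powr (p / ps i)) \<in> borel_measurable M"
    using assms by (intro borel_measurable_prod) measurable
  then show ?thesis
    by (simp add: nu_weight_def[abs_def])
qed

text \<open>
  Hoelder's inequality for the functions \<open>g i ^ ps i * \<sigma> i\<close> with exponents \<open>p / ps i\<close>: the density
  of \<open>\<nu>\<close> is chosen so that the product of their powers is \<open>(\<Prod>i. g i)^p * \<nu>\<close>. This identity needs
  positive weights, hence holds almost everywhere.
\<close>

lemma weighted_norm_prod_le:
  fixes \<sigma> :: "nat \<Rightarrow> real ^ 'n \<Rightarrow> real" and g :: "nat \<Rightarrow> real ^ 'n \<Rightarrow> ennreal"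
  assumes m: "m \<ge> 1" and ps: "\<And>i. i \<in> {1..m} \<Longrightarrow> 1 < ps i" and p: "1 < p" "1 / p = (\<Sum>i=1..m. 1 / ps i)"
    and \<sigma>: "\<And>i. i \<in> {1..m} \<Longrightarrow> weight (\<sigma> i)"
    and g [measurable]: "\<And>i. i \<in> {1..m} \<Longrightarrow> g i \<in> borel_measurable lebesgue"
  shows "weighted_norm p (nu_weight m p ps \<sigma>) (\<lambda>x. \<Prod>i=1..m. g i x)
    \<le> (\<Prod>i=1..m. weighted_norm (ps i) (\<sigma> i) (g i))"
proof -
  have [measurable]: "\<sigma> i \<in> borel_measurable lebesgue" if "i \<in> {1..m}" for i
    using borel_measurable_weight[OF \<sigma>[OF that]] .
  define h where "h i x = enn_powr (g i x) (ps i) * ennreal (\<sigma> i x)" for i x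
  have [measurable]: "h i \<in> borel_measurable lebesgue" if "i \<in> {1..m}" for i
    unfolding h_def[abs_def] using that by measurable
  have "AE x in lebesgue. \<forall>i\<in>{1..m}. 0 < \<sigma> i x"
    using \<sigma> by (intro AE_finite_allI) (auto simp: weight_def)
  then have "AE x in lebesgue. enn_powr (\<Prod>i=1..m. g i x) p * ennreal (nu_weight m p ps \<sigma> x)
      = (\<Prod>i=1..m. enn_powr (h i x) (p / ps i))"
  proof eventually_elim
    case (elim x)
    have "enn_powr (\<Prod>i=1..m. g i x) p * ennreal (nu_weight m p ps \<sigma> x)
        = (\<Prod>i=1..m. enn_powr (g i x) p * ennreal (\<sigma> i x powr (p / ps i)))"
      by (simp add: enn_powr_prod nu_weight_def prod_ennreal prod.distrib)
    also have "\<dots> = (\<Prod>i=1..m. enn_powr (h i x) (p / ps i))"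
    proof (rule prod.cong[OF refl])
      fix i assume i: "i \<in> {1..m}"
      then have "0 \<le> \<sigma> i x" "ps i \<noteq> 0" using elim ps[OF i] by (auto simp: less_imp_le)
      then show "enn_powr (g i x) p * ennreal (\<sigma> i x powr (p / ps i)) = enn_powr (h i x) (p / ps i)"
        by (simp add: h_def enn_powr_mult enn_powr_powr enn_powr_ennreal)
    qed
    finally show ?case .
  qed
  then have "(\<integral>\<^sup>+ x. enn_powr (\<Prod>i=1..m. g i x) p * ennreal (nu_weight m p ps \<sigma> x) \<partial>lebesgue)
      = (\<integral>\<^sup>+ x. (\<Prod>i=1..m. enn_powr (h i x) (p / ps i)) \<partial>lebesgue)"
    by (rule nn_integral_cong_AE)
  also have "\<dots> \<le> (\<Prod>i=1..m. enn_powr (\<integral>\<^sup>+ x. h i x \<partial>lebesgue) (p / ps i))"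
  proof (rule nn_integral_Hoelder)
    show "0 < p / ps i" if "i \<in> {1..m}" for i
      using p(1) ps[OF that] by simp
    have "(\<Sum>i=1..m. p / ps i) = p * (\<Sum>i=1..m. 1 / ps i)"
      by (simp add: sum_distrib_left)
    also have "\<dots> = 1"
      unfolding p(2)[symmetric] using p(1) by simp
    finally show "(\<Sum>i=1..m. p / ps i) = 1" .
  qed (use m in auto)
  finally have "weighted_norm p (nu_weight m p ps \<sigma>) (\<lambda>x. \<Prod>i=1..m. g i x)
      \<le> enn_powr (\<Prod>i=1..m. enn_powr (\<integral>\<^sup>+ x. h i x \<partial>lebesgue) (p / ps i)) (1 / p)"
    unfolding weighted_norm_def using p(1) by (intro enn_powr_mono) auto
  also have "\<dots> = (\<Prod>i=1..m. weighted_norm (ps i) (\<sigma> i) (g i))"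
    using p(1) by (simp add: enn_powr_prod enn_powr_powr weighted_norm_def h_def)
  finally show ?thesis .
qed

theorem lemma3p1:
  fixes D :: "(real ^ 'n) set set"
    and m :: nat
    and p A :: real
    and ps :: "nat \<Rightarrow> real"
    and \<sigma> :: "nat \<Rightarrow> real ^ 'n \<Rightarrow> real"
    and a :: "(real ^ 'n) set \<Rightarrow> real"
    and f :: "nat \<Rightarrow> real ^ 'n \<Rightarrow> complex"
  assumes "m \<ge> 1"
    and "\<And>i. i \<in> {1..m} \<Longrightarrow> 1 < ps i"
    and "1 < p"
    and "1 / p = (\<Sum>i=1..m. 1 / ps i)"
    and "dyadic_grid D"
    and "\<And>i. i \<in> {1..m} \<Longrightarrow> weight (\<sigma> i)"
    and "\<And>Q. Q \<in> D \<Longrightarrow> 0 \<le> a Q"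
    and "0 \<le> A"
    and "\<And>R. R \<in> D \<Longrightarrow>
           (\<Sum>\<^sub>\<infinity>Q\<in>{Q\<in>D. Q \<subseteq> R}. ennreal (a Q))
             \<le> ennreal A * (\<integral>\<^sup>+ x\<in>R. ennreal (\<Prod>i=1..m. \<sigma> i x powr (p / ps i)) \<partial>lebesgue)"
    and "\<And>i. i \<in> {1..m} \<Longrightarrow> in_weighted_Lp (ps i) (\<sigma> i) (f i)"
  shows "enn_powr (\<Sum>\<^sub>\<infinity>Q\<in>D. ennreal (a Q) * enn_powr (\<Prod>i=1..m. weighted_avg (\<sigma> i) (f i) Q) p) (1 / p)
           \<le> ennreal (A powr (1 / p)) * weighted_norm p (nu_weight m p ps \<sigma>) (dyadic_maximal D m \<sigma> f)
       \<and> ennreal (A powr (1 / p)) * weighted_norm p (nu_weight m p ps \<sigma>) (dyadic_maximal D m \<sigma> f)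
           \<le> ennreal (A powr (1 / p)) *
             (\<Prod>i=1..m. ennreal (conj_exponent (ps i)) *
                weighted_norm (ps i) (\<sigma> i) (\<lambda>x. ennreal (cmod (f i x))))"
proof
  note ps = assms(2) and p = assms(3) and D = assms(5) and w = assms(6) and f = assms(10)
  let ?\<nu> = "nu_weight m p ps \<sigma>"
  let ?M = "dyadic_maximal D m \<sigma> f"
  let ?avg = "\<lambda>Q. \<Prod>i=1..m. weighted_avg (\<sigma> i) (f i) Q"
  have p0: "0 < p" "0 < 1 / p" using p by auto
  have "(\<Sum>\<^sub>\<infinity>Q\<in>D. ennreal (a Q) * enn_powr (?avg Q) p)
      \<le> ennreal A * (\<integral>\<^sup>+ x. (SUP Q\<in>{Q\<in>D. x \<in> Q}. enn_powr (?avg Q) p) * ennreal (?\<nu> x) \<partial>lebesgue)"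
  proof (rule dyadic_carleson_embedding[OF D])
    show "?\<nu> \<in> borel_measurable lebesgue"
      by (intro borel_measurable_nu_weight borel_measurable_weight w)
    show "(\<Sum>\<^sub>\<infinity>Q\<in>{Q\<in>D. Q \<subseteq> R}. ennreal (a Q)) \<le> ennreal A * (\<integral>\<^sup>+ x\<in>R. ennreal (?\<nu> x) \<partial>lebesgue)"
      if "R \<in> D" for R
      using assms(9)[OF that] by (simp add: nu_weight_def)
    fix Q assume "Q \<in> D"
    then obtain s where s: "cube_of_side s Q" using dyadic_cube[OF D] by blast
    have "weighted_avg (\<sigma> i) (f i) Q \<noteq> top" if "i \<in> {1..m}" for i
      using weighted_avg_finite[OF w[OF that] s ps[OF that] f[OF that]] by auto
    then have "?avg Q \<noteq> top"
      by (subst ennreal_prod_eq_top) auto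
    then show "enn_powr (?avg Q) p < \<infinity>"
      using enn_powr_eq_top_iff[of "?avg Q" p] unfolding infinity_ennreal_def less_top[symmetric] by blast
  qed
  also have "\<dots> = ennreal A * (\<integral>\<^sup>+ x. enn_powr (?M x) p * ennreal (?\<nu> x) \<partial>lebesgue)"
    by (simp add: dyadic_maximal_def enn_powr_SUP[OF p0(1)])
  finally have "enn_powr (\<Sum>\<^sub>\<infinity>Q\<in>D. ennreal (a Q) * enn_powr (?avg Q) p) (1 / p)
      \<le> enn_powr (ennreal A * (\<integral>\<^sup>+ x. enn_powr (?M x) p * ennreal (?\<nu> x) \<partial>lebesgue)) (1 / p)"
    by (intro enn_powr_mono p0)
  also have "\<dots> = ennreal (A powr (1 / p)) * weighted_norm p ?\<nu> ?M"
    using assms(8) by (simp add: enn_powr_mult enn_powr_ennreal weighted_norm_def)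
  finally show "enn_powr (\<Sum>\<^sub>\<infinity>Q\<in>D. ennreal (a Q) * enn_powr (?avg Q) p) (1 / p)
      \<le> ennreal (A powr (1 / p)) * weighted_norm p ?\<nu> ?M" .
  have "weighted_norm p ?\<nu> ?M
      \<le> weighted_norm p ?\<nu> (\<lambda>x. \<Prod>i=1..m. SUP Q\<in>{Q\<in>D. x \<in> Q}. weighted_avg (\<sigma> i) (f i) Q)"
    unfolding weighted_norm_def
    by (intro enn_powr_mono p0 nn_integral_mono mult_right_mono dyadic_maximal_le_prod) simp
  also have "\<dots> \<le> (\<Prod>i=1..m. weighted_norm (ps i) (\<sigma> i) (\<lambda>x. SUP Q\<in>{Q\<in>D. x \<in> Q}. weighted_avg (\<sigma> i) (f i) Q))"
    by (rule weighted_norm_prod_le[OF assms(1) ps assms(3,4) w borel_measurable_dyadic_sup[OF D]])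
  also have "\<dots> \<le> (\<Prod>i=1..m. ennreal (conj_exponent (ps i)) *
                weighted_norm (ps i) (\<sigma> i) (\<lambda>x. ennreal (cmod (f i x))))"
    using weighted_dyadic_maximal_bound[OF D w ps f] by (intro prod_mono_ennreal) auto
  finally show "ennreal (A powr (1 / p)) * weighted_norm p ?\<nu> ?M
      \<le> ennreal (A powr (1 / p)) * (\<Prod>i=1..m. ennreal (conj_exponent (ps i)) *
                weighted_norm (ps i) (\<sigma> i) (\<lambda>x. ennreal (cmod (f i x))))"
    by (rule mult_left_mono) simp
qed

end
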